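(* Let $N, W$ be natural numbers with $4N \le W^2$ and $W < N$. Let $(L, U, t)$ be a certificate for $(N,W)$, with window list $L = ((m_1,c_1),\dots,(m_r,c_r))$, upper list $U = ((x_1,d_1),\dots,(x_s,d_s))$ and target $t$. Suppose that all listed divisor counts are correct, i.e. $c_i = \tau(m_i)$ for all $1 \le i \le r$ and $d_j = \tau(x_j)$ for all $1 \le j \le s$, and that the replay of the certificate passes. Then $a \sim b$ for all integers $a,b$ with $0 < a < N$ and $0 < b < N$.
   Context: For a positive integer $n$, $\tau(n)$ is the number of positive divisors of $n$, and $h(n) = n + \tau(n)$; $h^{[k]}$ denotes the $k$-th iterate of $h$ ($h^{[0]}$ is the identity). Write $a \sim b$ ("$a$ and $b$ coalesce") if there exist integers $i,j \ge 0$ with $h^{[i]}(a) = h^{[j]}(b)$. Certificate. A certificate for $(N,W)$ consists of a finite list $L = ((m_1,c_1),\dots,(m_r,c_r))$ of pairs of natural numbers (the window list), a finite (possibly empty) list $U = ((x_1,d_1),\dots,(x_s,d_s))$ of pairs of natural numbers (the upper list), and a natural number $t$ (the target). The intended meaning is that the $m_i$ run in increasing order through all integers of the window $[N-W, N)$, the $x_j$ are orbit points $\ge N$ in increasing order, and $c_i, d_j$ are the claimed values $\tau(m_i), \tau(x_j)$. Replay. The replay maintains a pending list of natural numbers, kept sorted in increasing order and without duplicates (inserting an integer already present leaves the list unchanged), initially empty. (1) Window phase: process $(m_1,c_1),\dots,(m_r,c_r)$ in order. Each $m_i$ must be the expected next integer, i.e. $m_i = N - W + (i-1)$; otherwise the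 replay fails. If $m_i + c_i \ge N$, insert $m_i + c_i$ into the pending list; if $m_i + c_i < N$, leave the pending list unchanged. (2) Upper phase: starting with the pending list left by the window phase, process $(x_1,d_1),\dots,(x_s,d_s)$ in order. Each $x_j$ must equal the head (smallest element) of the current pending list; otherwise the replay fails. Remove $x_j$ from the pending list and insert $x_j + d_j$. The replay passes if no step fails, the window list has exactly $W$ entries ($r = W$), and at the end the pending list is exactly the one-element list $[t]$. *)

theory Defs
  imports Main
begin

text \<open>
  Only positive arguments matter below. At \<open>n = 0\<close> the set of divisors is infinite, so
  \<open>tau 0 = 0\<close> by the convention for \<^const>\<open>card\<close>.
\<close>

definition tau :: "nat \<Rightarrow> nat" where
  "tau n = card {d. d dvd n}"

definition h :: "nat \<Rightarrow> nat" where
  "h n = n + tau n"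

definition coalesce :: "nat \<Rightarrow> nat \<Rightarrow> bool" (infix "\<sim>" 50) where
  "a \<sim> b \<longleftrightarrow> (\<exists>i j. (h ^^ i) a = (h ^^ j) b)"

text \<open>
  A certificate consists of a window list \<open>L\<close> and an upper list \<open>U\<close>, whose entries pair a number
  with its claimed divisor count, and a target \<open>t\<close>. Each replay phase maps a pending list to the
  resulting pending list; \<^const>\<open>None\<close> is failure. The library function
  \<open>insort_insert\<close> inserts into a sorted list and changes nothing if the element is already there.

  In \<open>window_phase N k L P\<close>, \<open>k\<close> is the expected next integer of the window.
\<close>

fun window_phase :: "nat \<Rightarrow> nat \<Rightarrow> (nat \<times> nat) list \<Rightarrow> nat list \<Rightarrow> nat list option" where
  "window_phase N k [] P = Some P"
| "window_phase N k ((m, c) # L) P =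
    (if m = k
     then window_phase N (Suc k) L (if m + c \<ge> N then insort_insert (m + c) P else P)
     else None)"

fun upper_phase :: "(nat \<times> nat) list \<Rightarrow> nat list \<Rightarrow> nat list option" where
  "upper_phase [] P = Some P"
| "upper_phase ((x, d) # U) [] = None"
| "upper_phase ((x, d) # U) (p # P) =
    (if x = p then upper_phase U (insort_insert (x + d) P) else None)"

definition replay :: "nat \<Rightarrow> nat \<Rightarrow> (nat \<times> nat) list \<Rightarrow> (nat \<times> nat) list \<Rightarrow> nat list option" where
  "replay N W L U = Option.bind (window_phase N (N - W) L []) (upper_phase U)"

definition replay_passes ::
  "nat \<Rightarrow> nat \<Rightarrow> (nat \<times> nat) list \<Rightarrow> (nat \<times> nat) list \<Rightarrow> nat \<Rightarrow> bool" where
  "replay_passes N W L U t \<longleftrightarrow> length L = W \<and> replay N W L U = Some [t]"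

end

theory Submission
  imports Defs
begin

text \<open>
  Divisors of \<open>n\<close> come in pairs \<open>d\<close>, \<open>n div d\<close> whose smaller member is at most \<open>\<surd>n\<close>, so
  \<open>tau n \<le> 2 \<surd>n\<close> (lemma \<open>tau_square_le\<close>). Together with \<open>4 N \<le> W\<^sup>2\<close> this says that a step of
  \<open>h\<close> starting below \<open>N\<close> is shorter than \<open>W\<close>. An orbit that starts at a positive number below
  \<open>N\<close> strictly increases, so it has to cross \<open>N\<close>, and it is too slow to jump over the window
  \<open>[N - W, N)\<close>: its last point below \<open>N\<close> is in the window.

  The window phase collects the first point \<open>\<ge> N\<close> of every orbit that leaves the window
  (lemma \<open>window_phase_collects_exits\<close>). A step of the upper phase replaces one pending number by
  its image under \<open>h\<close>, so that every number that was pending at some time still has a pending number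
  in its orbit (lemma \<open>upper_phase_preserves_reaching\<close>). When only \<open>t\<close> is pending, all the orbits
  contain \<open>t\<close>, and therefore any two of them meet.
\<close>

text \<open>
  The divisors \<open>d\<close> with \<open>d * d \<le> n\<close> all lie between 1 and the largest of them, whose square is at
  most \<open>n\<close>, and the map \<open>d \<mapsto> n div d\<close> produces the remaining divisors from them.
\<close>

lemma tau_square_le:
  assumes "0 < n"
  shows "(tau n)\<^sup>2 \<le> 4 * n"
proof -
  define S where "S = {d. d dvd n \<and> d * d \<le> n}"
  have fin: "finite S"
    unfolding S_def using assms by (intro finite_subset[OF _ finite_divisors_nat[of n]]) auto
  have one: "1 \<in> S"
    using assms by (simp add: S_def)
  have cover: "{d. d dvd n} \<subseteq> S \<union> (\<lambda>d. n div d) ` S"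
  proof
    fix d assume "d \<in> {d. d dvd n}"
    then obtain e where e: "n = d * e" by (auto elim: dvdE)
    have pos: "0 < d" "0 < e" using assms e by auto
    show "d \<in> S \<union> (\<lambda>d. n div d) ` S"
    proof (cases "d \<le> e")
      case True
      then show ?thesis by (simp add: S_def e)
    next
      case False
      then have "e \<in> S" by (simp add: S_def e)
      moreover have "d = n div e" using e pos by simp
      ultimately show ?thesis by blast
    qed
  qed
  have "tau n \<le> card (S \<union> (\<lambda>d. n div d) ` S)"
    unfolding tau_def by (rule card_mono) (use cover fin in auto)
  also have "\<dots> \<le> card S + card S"
    by (intro order_trans[OF card_Un_le] add_left_mono card_image_le fin)
  finally have tau_le: "tau n \<le> 2 * card S" by simp
  have "Max S \<in> S" using fin one by (intro Max_in) auto
  then have Max_square: "Max S * Max S \<le> n" by (simp add: S_def)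
  have "S \<subseteq> {1..Max S}"
    using fin assms by (auto simp: S_def intro: Suc_leI dvd_pos_nat)
  then have "card S \<le> Max S"
    using card_mono[of "{1..Max S}" S] by simp
  with tau_le have "tau n \<le> 2 * Max S" by simp
  then have "(tau n)\<^sup>2 \<le> (2 * Max S)\<^sup>2" by (rule power_mono) simp
  also have "\<dots> \<le> 4 * n" using Max_square by (simp add: power2_eq_square)
  finally show ?thesis .
qed

lemma less_h:
  assumes "0 < n"
  shows "n < h n"
proof -
  have "1 \<in> {d. d dvd n}" by simp
  then have "0 < tau n"
    unfolding tau_def using assms by (metis card_gt_0_iff empty_iff finite_divisors_nat)
  then show ?thesis by (simp add: h_def)
qed

text \<open>
  Unlike \<open>\<sim>\<close>, this relation is plainly transitive, so that orbit segments from the different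
  phases can be concatenated.
\<close>

definition reaches :: "nat \<Rightarrow> nat \<Rightarrow> bool" where
  "reaches a b \<longleftrightarrow> (\<exists>i. (h ^^ i) a = b)"

lemma reaches_refl: "reaches a a"
  unfolding reaches_def by (rule exI[of _ 0]) simp

lemma reaches_step:
  assumes "reaches (h a) b"
  shows "reaches a b"
proof -
  obtain i where "(h ^^ i) (h a) = b" using assms by (auto simp: reaches_def)
  then have "(h ^^ Suc i) a = b" by (simp only: funpow_Suc_right comp_apply)
  then show ?thesis unfolding reaches_def by blast
qed

lemma reaches_trans:
  assumes "reaches a b" and "reaches b c"
  shows "reaches a c"
  using assms by (metis reaches_def funpow_add comp_apply)

lemma coalesce_if_reach_common:
  assumes "reaches a t" and "reaches b t"
  shows "a \<sim> b"
  using assms by (metis reaches_def coalesce_def)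

text \<open>
  The inclusion of the old pending list is what carries an exit point that was inserted early
  through the rest of the phase.
\<close>

lemma window_phase_collects_exits:
  assumes "window_phase N k L P = Some Q"
    and "\<forall>(m, c) \<in> set L. c = tau m"
  shows "set P \<subseteq> set Q \<and> (\<forall>m. k \<le> m \<and> m < k + length L \<and> N \<le> h m \<longrightarrow> h m \<in> set Q)"
  using assms
proof (induction N k L P rule: window_phase.induct)
  case (1 N k P)
  then show ?case by auto
next
  case (2 N k m c L P)
  let ?P = "if m + c \<ge> N then insort_insert (m + c) P else P"
  from "2.prems" have m: "m = k" and c: "c = tau k"
    and phase: "window_phase N (Suc k) L ?P = Some Q"
    by (auto split: if_splits)
  have IH: "set ?P \<subseteq> set Q"
    "\<forall>m. Suc k \<le> m \<and> m < Suc k + length L \<and> N \<le> h m \<longrightarrow> h m \<in> set Q"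
    using "2.IH"[OF m phase] "2.prems"(2) by auto
  have old: "set P \<subseteq> set Q"
    using IH(1) by (auto simp: set_insort_insert split: if_splits)
  have first: "N \<le> h k \<longrightarrow> h k \<in> set Q"
    using IH(1) by (auto simp: set_insort_insert h_def m c split: if_splits)
  have "h j \<in> set Q" if "k \<le> j" "j < k + length ((m, c) # L)" "N \<le> h j" for j
    using that first IH(2) by (cases "j = k") auto
  with old show ?case by blast
qed

text \<open>
  Only the head \<open>x\<close> leaves the pending list, and the next point \<open>h x\<close> of its orbit takes its place.
\<close>

lemma upper_phase_preserves_reaching:
  assumes "upper_phase U P = Some Q"
    and "\<forall>(x, d) \<in> set U. d = tau x"
    and "p \<in> set P"
  shows "\<exists>q \<in> set Q. reaches p q"
  using assms
proof (induction U P arbitrary: p rule: upper_phase.induct)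
  case (1 P)
  then show ?case by (auto intro: reaches_refl)
next
  case (2 x d U)
  then show ?case by simp
next
  case (3 x d U y P)
  from "3.prems" have x: "x = y" and d: "x + d = h x"
    and phase: "upper_phase U (insort_insert (x + d) P) = Some Q"
    by (auto simp: h_def split: if_splits)
  have IH: "\<exists>q \<in> set Q. reaches p' q" if "p' = h x \<or> p' \<in> set P" for p'
    using "3.IH"[OF x phase] "3.prems"(2) that by (auto simp: d set_insort_insert)
  show ?case
  proof (cases "p = x")
    case True
    then show ?thesis using IH[of "h x"] by (auto intro: reaches_step)
  next
    case False
    then show ?thesis using IH[of p] "3.prems"(3) x by auto
  qed
qed

lemma tau_less_window_width:
  assumes "4 * N \<le> W\<^sup>2" and "0 < a" and "a < N"
  shows "tau a < W"
proof -
  have "(tau a)\<^sup>2 < W\<^sup>2" using tau_square_le[OF assms(2)] assms by linarith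
  then show ?thesis by (rule power_less_imp_less_base) simp
qed

text \<open>
  The point \<open>m\<close> is the last point of the orbit below \<open>N\<close>: the step from it gains less than \<open>W\<close>
  and still gets to \<open>N\<close>, which forces \<open>m\<close> into the window.
\<close>

lemma orbit_exits_through_window:
  assumes "4 * N \<le> W\<^sup>2" and "0 < a" and "a < N"
  shows "\<exists>m. N - W \<le> m \<and> m < N \<and> N \<le> h m \<and> reaches a (h m)"
  using assms(2,3)
proof (induction "N - a" arbitrary: a rule: less_induct)
  case less
  show ?case
  proof (cases "h a < N")
    case True
    moreover have "a < h a" using less.prems by (intro less_h)
    ultimately obtain m where "N - W \<le> m" "m < N" "N \<le> h m" "reaches (h a) (h m)"
      using less.hyps[of "h a"] less.prems by (auto simp: diff_less_mono2)
    then show ?thesis by (blast intro: reaches_step)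
  next
    case False
    moreover have "tau a < W"
      using tau_less_window_width assms(1) less.prems by blast
    ultimately have "N - W \<le> a" "N \<le> h a" by (auto simp: h_def)
    then show ?thesis
      using less.prems by (blast intro: reaches_step reaches_refl)
  qed
qed

theorem theorem3p1:
  fixes N W t :: nat
    and L U :: "(nat \<times> nat) list"
  assumes "4 * N \<le> W ^ 2"
    and "W < N"
    and "\<forall>(m, c) \<in> set L. c = tau m"
    and "\<forall>(x, d) \<in> set U. d = tau x"
    and "replay_passes N W L U t"
  shows "\<forall>a b. 0 < a \<and> a < N \<and> 0 < b \<and> b < N \<longrightarrow> a \<sim> b"
proof -
  from assms(5) obtain P where len: "length L = W"
    and window: "window_phase N (N - W) L [] = Some P"
    and upper: "upper_phase U P = Some [t]"
    by (auto simp: replay_passes_def replay_def bind_eq_Some_conv)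
  have "reaches a t" if a: "0 < a" "a < N" for a
  proof -
    obtain m where m: "N - W \<le> m" "m < N" "N \<le> h m" "reaches a (h m)"
      using orbit_exits_through_window[OF assms(1) a] by blast
    have "h m \<in> set P"
      using window_phase_collects_exits[OF window assms(3)] m len assms(2) by auto
    then have "reaches (h m) t"
      using upper_phase_preserves_reaching[OF upper assms(4)] by auto
    with m(4) show ?thesis by (rule reaches_trans)
  qed
  then show ?thesis by (blast intro: coalesce_if_reach_common)
qed

end
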